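(* Every left-downward closed formula $\varphi\in \mathrm{TeamLTL}^{l}(\sim, \vee_B)$ is logically equivalent to a quasi-flat formula $\varphi^*$, i.e., one of the form $\bigvee_{B,\,i\in I} (\alpha_i\wedge \bigwedge_{j\in J_i} \exists \beta_{i,j})$ with $\alpha_i,\beta_{i,j}$ LTL-formulae.
   Context: $\mathrm{TeamLTL}^{l}(\sim,\vee_B)$ is LTL (negation normal form, $\wedge,\vee,\mathsf{X},\mathsf{G},\mathsf{U}$) under the lax set-based asynchronous team semantics $\models^l$, extended with the Boolean negation $\sim$ ($T\models^l\sim\varphi$ iff $T\not\models^l\varphi$) and Boolean disjunction $\vee_B$ ($T\models^l\varphi\vee_B\psi$ iff $T\models^l\varphi$ or $T\models^l\psi$). A formula is left-downward closed if in all its subformulae $\mathsf{G}\psi$ and $\psi\mathsf{U}\theta$, $\psi$ is a formula of $\mathrm{TeamLTL}(\vee_B)$ (no $\sim$). $\exists\beta$ abbreviates $\sim\beta^d$, where $\beta^d$ is the negation normal form of $\neg\beta$; $T\models^l\exists\beta$ iff some $t\in T$ satisfies $\beta$. *)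

theory Defs
  imports "HOL-Library.Omega_Words_Fun" "HOL-Library.FuncSet"
begin

section \<open>Syntax\<close>

text \<open>The atomic propositions are the elements of the type variable \<open>'p\<close>.\<close>

datatype 'p fm =
    Atom 'p
  | NegAtom 'p
  | Conj "'p fm" "'p fm"
  | Disj "'p fm" "'p fm"
  | BDisj "'p fm" "'p fm"
  | BNeg "'p fm"
  | Next "'p fm"
  | Glob "'p fm"
  | Until "'p fm" "'p fm"

primrec subfms :: "'p fm \<Rightarrow> 'p fm set" where
  "subfms (Atom p) = {Atom p}"
| "subfms (NegAtom p) = {NegAtom p}"
| "subfms (Conj \<phi> \<psi>) = insert (Conj \<phi> \<psi>) (subfms \<phi> \<union> subfms \<psi>)"
| "subfms (Disj \<phi> \<psi>) = insert (Disj \<phi> \<psi>) (subfms \<phi> \<union> subfms \<psi>)"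
| "subfms (BDisj \<phi> \<psi>) = insert (BDisj \<phi> \<psi>) (subfms \<phi> \<union> subfms \<psi>)"
| "subfms (BNeg \<phi>) = insert (BNeg \<phi>) (subfms \<phi>)"
| "subfms (Next \<phi>) = insert (Next \<phi>) (subfms \<phi>)"
| "subfms (Glob \<phi>) = insert (Glob \<phi>) (subfms \<phi>)"
| "subfms (Until \<phi> \<psi>) = insert (Until \<phi> \<psi>) (subfms \<phi> \<union> subfms \<psi>)"

definition teamltl_bor :: "'p fm \<Rightarrow> bool" where
  "teamltl_bor \<phi> \<longleftrightarrow> (\<forall>\<psi>. BNeg \<psi> \<notin> subfms \<phi>)"

definition ltl :: "'p fm \<Rightarrow> bool" where
  "ltl \<phi> \<longleftrightarrow> (\<forall>\<psi>. BNeg \<psi> \<notin> subfms \<phi>) \<and> (\<forall>\<psi> \<theta>. BDisj \<psi> \<theta> \<notin> subfms \<phi>)"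

definition left_downward_closed :: "'p fm \<Rightarrow> bool" where
  "left_downward_closed \<phi> \<longleftrightarrow>
     (\<forall>\<psi>. Glob \<psi> \<in> subfms \<phi> \<longrightarrow> teamltl_bor \<psi>) \<and>
     (\<forall>\<psi> \<theta>. Until \<psi> \<theta> \<in> subfms \<phi> \<longrightarrow> teamltl_bor \<psi>)"


section \<open>Lax set-based asynchronous semantics\<close>

type_synonym 'p trace = "'p set word"

text \<open>
  \<open>lax_postfix T f\<close> is $T[f,\infty)$ for $f : T \to \mathcal{P}(\mathbb{N})^+$. Functions with
  domain \<open>T\<close> are represented by total functions whose values outside \<open>T\<close> are irrelevant.
\<close>

definition lax_postfix :: "'p trace set \<Rightarrow> ('p trace \<Rightarrow> nat set) \<Rightarrow> 'p trace set" where
  "lax_postfix T f = {suffix s t | t s. t \<in> T \<and> s \<in> f t}"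

abbreviation nonempty_nat_sets :: "nat set set" where
  "nonempty_nat_sets \<equiv> {S. S \<noteq> {}}"

text \<open>
  \<open>lax_less T' f' f\<close> is $f' < f$ for $f' : T' \to \mathcal{P}(\mathbb{N})^+$: for all $t \in T'$,
  $\min f'(t) \le \min f(t)$ and, if $\max f(t)$ exists, $\max f'(t) < \max f(t)$ (in particular
  $\max f'(t)$ exists as well).
\<close>

definition lax_less ::
  "'p trace set \<Rightarrow> ('p trace \<Rightarrow> nat set) \<Rightarrow> ('p trace \<Rightarrow> nat set) \<Rightarrow> bool" where
  "lax_less T' f' f \<longleftrightarrow>
     (\<forall>t\<in>T'. Inf (f' t) \<le> Inf (f t) \<and>
       (finite (f t) \<longrightarrow> finite (f' t) \<and> Max (f' t) < Max (f t)))"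

text \<open>The set $\{t \in T \mid \max f(t) \neq 0\}$; it contains the \<open>t\<close> with \<open>f t\<close> unbounded.\<close>

definition nonzero_part :: "'p trace set \<Rightarrow> ('p trace \<Rightarrow> nat set) \<Rightarrow> 'p trace set" where
  "nonzero_part T f = {t \<in> T. \<not> (finite (f t) \<and> Max (f t) = 0)}"

fun team_sat :: "'p trace set \<Rightarrow> 'p fm \<Rightarrow> bool"  (infix \<open>\<Turnstile>\<^sub>l\<close> 50) where
  "T \<Turnstile>\<^sub>l Atom p \<longleftrightarrow> (\<forall>t\<in>T. p \<in> t 0)"
| "T \<Turnstile>\<^sub>l NegAtom p \<longleftrightarrow> (\<forall>t\<in>T. p \<notin> t 0)"
| "T \<Turnstile>\<^sub>l Conj \<phi> \<psi> \<longleftrightarrow> T \<Turnstile>\<^sub>l \<phi> \<and> T \<Turnstile>\<^sub>l \<psi>"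
| "T \<Turnstile>\<^sub>l Disj \<phi> \<psi> \<longleftrightarrow> (\<exists>T1 T2. T1 \<union> T2 = T \<and> T1 \<Turnstile>\<^sub>l \<phi> \<and> T2 \<Turnstile>\<^sub>l \<psi>)"
| "T \<Turnstile>\<^sub>l BDisj \<phi> \<psi> \<longleftrightarrow> T \<Turnstile>\<^sub>l \<phi> \<or> T \<Turnstile>\<^sub>l \<psi>"
| "T \<Turnstile>\<^sub>l BNeg \<phi> \<longleftrightarrow> \<not> T \<Turnstile>\<^sub>l \<phi>"
| "T \<Turnstile>\<^sub>l Next \<phi> \<longleftrightarrow> suffix 1 ` T \<Turnstile>\<^sub>l \<phi>"
| "T \<Turnstile>\<^sub>l Glob \<phi> \<longleftrightarrow> (\<forall>f \<in> T \<rightarrow> nonempty_nat_sets. lax_postfix T f \<Turnstile>\<^sub>l \<phi>)"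
| "T \<Turnstile>\<^sub>l Until \<phi> \<psi> \<longleftrightarrow>
     (\<exists>f \<in> T \<rightarrow> nonempty_nat_sets.
        lax_postfix T f \<Turnstile>\<^sub>l \<psi> \<and>
        (\<forall>f' \<in> nonzero_part T f \<rightarrow> nonempty_nat_sets.
           lax_less (nonzero_part T f) f' f \<longrightarrow>
           lax_postfix (nonzero_part T f) f' \<Turnstile>\<^sub>l \<phi> \<or> nonzero_part T f = {}))"

definition logically_equivalent :: "'p fm \<Rightarrow> 'p fm \<Rightarrow> bool" where
  "logically_equivalent \<phi> \<psi> \<longleftrightarrow> (\<forall>T. T \<Turnstile>\<^sub>l \<phi> \<longleftrightarrow> T \<Turnstile>\<^sub>l \<psi>)"


section \<open>Quasi-flat formulae\<close>

text \<open>Truth is $p \vee \neg p$ for an arbitrary but fixed atom $p$.\<close>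

definition Top :: "'p fm" where
  "Top = Disj (Atom undefined) (NegAtom undefined)"

text \<open>
  \<open>dual \<beta>\<close> is the negation normal form of $\neg\beta$ for an LTL-formula \<open>\<beta>\<close>; it is deliberately
  unspecified outside LTL. As the syntax has neither eventually nor release,
  $\neg\mathsf{G}\varphi$ is written as $\top\mathsf{U}\neg\varphi$, and
  $\neg(\varphi\mathsf{U}\psi)$ as the weak until of $\neg\psi$ and $\neg\varphi\wedge\neg\psi$.
\<close>

fun dual :: "'p fm \<Rightarrow> 'p fm" where
  "dual (Atom p) = NegAtom p"
| "dual (NegAtom p) = Atom p"
| "dual (Conj \<phi> \<psi>) = Disj (dual \<phi>) (dual \<psi>)"
| "dual (Disj \<phi> \<psi>) = Conj (dual \<phi>) (dual \<psi>)"
| "dual (Next \<phi>) = Next (dual \<phi>)"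
| "dual (Glob \<phi>) = Until Top (dual \<phi>)"
| "dual (Until \<phi> \<psi>) =
     Disj (Until (dual \<psi>) (Conj (dual \<phi>) (dual \<psi>))) (Glob (dual \<psi>))"

definition Exists :: "'p fm \<Rightarrow> 'p fm" where
  "Exists \<beta> = BNeg (dual \<beta>)"

text \<open>Only used on nonempty lists.\<close>

fun big_bdisj :: "'p fm list \<Rightarrow> 'p fm" where
  "big_bdisj [\<phi>] = \<phi>"
| "big_bdisj (\<phi> # \<psi> # \<phi>s) = BDisj \<phi> (big_bdisj (\<psi> # \<phi>s))"

text \<open>
  \<open>flat_disjunct \<alpha> [\<beta>\<^sub>1, \<dots>, \<beta>\<^sub>n]\<close> is $\alpha \wedge \exists\beta_1 \wedge \dots \wedge \exists\beta_n$, which is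
  just $\alpha$ for $n = 0$.
\<close>

definition flat_disjunct :: "'p fm \<Rightarrow> 'p fm list \<Rightarrow> 'p fm" where
  "flat_disjunct \<alpha> \<beta>s = foldl (\<lambda>\<phi> \<beta>. Conj \<phi> (Exists \<beta>)) \<alpha> \<beta>s"

definition quasi_flat :: "'p fm \<Rightarrow> bool" where
  "quasi_flat \<phi> \<longleftrightarrow>
     (\<exists>ds. ds \<noteq> [] \<and>
       (\<forall>(\<alpha>, \<beta>s) \<in> set ds. ltl \<alpha> \<and> (\<forall>\<beta> \<in> set \<beta>s. ltl \<beta>)) \<and>
       \<phi> = big_bdisj (map (\<lambda>(\<alpha>, \<beta>s). flat_disjunct \<alpha> \<beta>s) ds))"

end

theory Submission
  imports Defs
begin

text \<open>
  LTL-formulae are flat: a team satisfies one iff each of its traces does. Hence a disjunct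
  $\alpha \wedge \bigwedge_j \exists\beta_j$ says that all traces satisfy $\alpha$ and each
  $\beta_j$ has a witness in the team, and it suffices to push every connective through Boolean
  disjunctions of such disjuncts. For $\psi\mathsf{U}\theta$ and $\mathsf{G}\psi$ the operand $\psi$
  is without Boolean negation, so that it becomes a disjunction of LTL-formulae $\alpha_i$. The teams
  on which $\psi$ is evaluated have a largest element, and the $\alpha_i$ true there is true in all of
  them; the disjunction therefore commutes with the temporal operator. Because the semantics
  is lax, in $\alpha\mathsf{U}(\gamma \wedge \bigwedge_j \exists\delta_j)$ each trace may be assigned
  all positions at which its until is fulfilled, which turns the witness for $\delta_j$ into a
  witness for $\alpha\mathsf{U}(\gamma\wedge\delta_j)$.
\<close>

section \<open>Flatness of LTL\<close>

lemma ltl_simps [simp]: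
  "ltl (Atom p)"
  "ltl (NegAtom p)"
  "ltl (Conj \<phi> \<psi>) \<longleftrightarrow> ltl \<phi> \<and> ltl \<psi>"
  "ltl (Disj \<phi> \<psi>) \<longleftrightarrow> ltl \<phi> \<and> ltl \<psi>"
  "\<not> ltl (BDisj \<phi> \<psi>)"
  "\<not> ltl (BNeg \<phi>)"
  "ltl (Next \<phi>) \<longleftrightarrow> ltl \<phi>"
  "ltl (Glob \<phi>) \<longleftrightarrow> ltl \<phi>"
  "ltl (Until \<phi> \<psi>) \<longleftrightarrow> ltl \<phi> \<and> ltl \<psi>"
  by (auto simp: ltl_def)

lemma teamltl_bor_simps [simp]:
  "teamltl_bor (Conj \<phi> \<psi>) \<longleftrightarrow> teamltl_bor \<phi> \<and> teamltl_bor \<psi>"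
  "teamltl_bor (Disj \<phi> \<psi>) \<longleftrightarrow> teamltl_bor \<phi> \<and> teamltl_bor \<psi>"
  "teamltl_bor (BDisj \<phi> \<psi>) \<longleftrightarrow> teamltl_bor \<phi> \<and> teamltl_bor \<psi>"
  "\<not> teamltl_bor (BNeg \<phi>)"
  "teamltl_bor (Next \<phi>) \<longleftrightarrow> teamltl_bor \<phi>"
  "teamltl_bor (Glob \<phi>) \<longleftrightarrow> teamltl_bor \<phi>"
  "teamltl_bor (Until \<phi> \<psi>) \<longleftrightarrow> teamltl_bor \<phi> \<and> teamltl_bor \<psi>"
  by (auto simp: teamltl_bor_def)

lemma left_downward_closed_simps [simp]:
  "left_downward_closed (Conj \<phi> \<psi>) \<longleftrightarrow> left_downward_closed \<phi> \<and> left_downward_closed \<psi>"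
  "left_downward_closed (Disj \<phi> \<psi>) \<longleftrightarrow> left_downward_closed \<phi> \<and> left_downward_closed \<psi>"
  "left_downward_closed (BDisj \<phi> \<psi>) \<longleftrightarrow> left_downward_closed \<phi> \<and> left_downward_closed \<psi>"
  "left_downward_closed (BNeg \<phi>) \<longleftrightarrow> left_downward_closed \<phi>"
  "left_downward_closed (Next \<phi>) \<longleftrightarrow> left_downward_closed \<phi>"
  "left_downward_closed (Glob \<phi>) \<longleftrightarrow> teamltl_bor \<phi> \<and> left_downward_closed \<phi>"
  "left_downward_closed (Until \<phi> \<psi>) \<longleftrightarrow>
     teamltl_bor \<phi> \<and> left_downward_closed \<phi> \<and> left_downward_closed \<psi>"
  by (auto simp: left_downward_closed_def)

text \<open>Only meaningful for LTL-formulae; the values on the Boolean connectives are junk.\<close>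

fun trace_sat :: "'p trace \<Rightarrow> 'p fm \<Rightarrow> bool" where
  "trace_sat t (Atom p) \<longleftrightarrow> p \<in> t 0"
| "trace_sat t (NegAtom p) \<longleftrightarrow> p \<notin> t 0"
| "trace_sat t (Conj \<phi> \<psi>) \<longleftrightarrow> trace_sat t \<phi> \<and> trace_sat t \<psi>"
| "trace_sat t (Disj \<phi> \<psi>) \<longleftrightarrow> trace_sat t \<phi> \<or> trace_sat t \<psi>"
| "trace_sat t (BDisj \<phi> \<psi>) \<longleftrightarrow> False"
| "trace_sat t (BNeg \<phi>) \<longleftrightarrow> False"
| "trace_sat t (Next \<phi>) \<longleftrightarrow> trace_sat (suffix 1 t) \<phi>"
| "trace_sat t (Glob \<phi>) \<longleftrightarrow> (\<forall>s. trace_sat (suffix s t) \<phi>)"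
| "trace_sat t (Until \<phi> \<psi>) \<longleftrightarrow>
     (\<exists>s. trace_sat (suffix s t) \<psi> \<and> (\<forall>j<s. trace_sat (suffix j t) \<phi>))"

section \<open>Temporal operators over disjunctions of tracewise conditions\<close>

lemma ball_lax_postfix: "(\<forall>u\<in>lax_postfix T f. P u) \<longleftrightarrow> (\<forall>t\<in>T. \<forall>s\<in>f t. P (suffix s t))"
  by (auto simp: lax_postfix_def)

lemma bex_lax_postfix: "(\<exists>u\<in>lax_postfix T f. P u) \<longleftrightarrow> (\<exists>t\<in>T. \<exists>s\<in>f t. P (suffix s t))"
  by (auto simp: lax_postfix_def)

text \<open>The constant function \<open>UNIV\<close> yields a team containing every other
  \<open>lax_postfix T f\<close>, and a tracewise condition passes to subteams, so the disjunct
  chosen for it serves all \<open>f\<close>. Abstract \<open>A\<close> and \<open>P\<close> let the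
  lemma serve both flatness of LTL and the normal form.\<close>

lemma Glob_iff_disjunction:
  assumes \<phi>: "\<And>U. U \<Turnstile>\<^sub>l \<phi> \<longleftrightarrow> (\<exists>a\<in>A. \<forall>t\<in>U. P a t)"
  shows "T \<Turnstile>\<^sub>l Glob \<phi> \<longleftrightarrow> (\<exists>a\<in>A. \<forall>t\<in>T. \<forall>s. P a (suffix s t))"
proof
  assume "T \<Turnstile>\<^sub>l Glob \<phi>"
  then have "lax_postfix T (\<lambda>_. UNIV) \<Turnstile>\<^sub>l \<phi>" by auto
  then show "\<exists>a\<in>A. \<forall>t\<in>T. \<forall>s. P a (suffix s t)" by (simp add: \<phi> ball_lax_postfix)
qed (auto simp: \<phi> ball_lax_postfix)

lemma nonzero_partI:
  assumes "t \<in> T" "s \<in> f t" "0 < s"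
  shows "t \<in> nonzero_part T f"
  using assms by (auto simp: nonzero_part_def dest: Max_ge)

lemma nonzero_partE:
  assumes "t \<in> nonzero_part T f" "f t \<noteq> {}"
  obtains s where "s \<in> f t" "0 < s"
proof (cases "finite (f t)")
  case True
  then show ?thesis using assms that[of "Max (f t)"] by (auto simp: nonzero_part_def)
next
  case False
  then show ?thesis using that by (auto simp: infinite_nat_iff_unbounded)
qed

text \<open>
  The largest function below \<open>f\<close> maps \<open>t\<close> to all positions strictly before some element of \<open>f t\<close>.
\<close>

lemma Until_iff_disjunction:
  assumes \<phi>: "\<And>U. U \<Turnstile>\<^sub>l \<phi> \<longleftrightarrow> (\<exists>a\<in>A. \<forall>t\<in>U. P a t)" and "A \<noteq> {}"
  shows "T \<Turnstile>\<^sub>l Until \<phi> \<psi> \<longleftrightarrow>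
    (\<exists>a\<in>A. \<exists>f \<in> T \<rightarrow> nonempty_nat_sets. lax_postfix T f \<Turnstile>\<^sub>l \<psi> \<and>
       (\<forall>t\<in>T. \<forall>s\<in>f t. \<forall>j<s. P a (suffix j t)))"
    (is "?L \<longleftrightarrow> ?R")
proof
  assume ?L
  then obtain f where f: "f \<in> T \<rightarrow> nonempty_nat_sets" "lax_postfix T f \<Turnstile>\<^sub>l \<psi>"
    and less: "\<And>f'. \<lbrakk>f' \<in> nonzero_part T f \<rightarrow> nonempty_nat_sets; lax_less (nonzero_part T f) f' f\<rbrakk>
      \<Longrightarrow> lax_postfix (nonzero_part T f) f' \<Turnstile>\<^sub>l \<phi> \<or> nonzero_part T f = {}"
    by auto
  define g where "g t = {j. \<exists>s\<in>f t. j < s}" for t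
  have ne: "f t \<noteq> {}" if "t \<in> nonzero_part T f" for t
    using f(1) that by (auto simp: nonzero_part_def)
  have zero: "0 \<in> g t" if "t \<in> nonzero_part T f" for t
    using nonzero_partE[OF that ne[OF that]] by (auto simp: g_def)
  \<comment> \<open>On these traces \<open>g t\<close> has minimum 0, and a finite
    \<open>f t\<close> bounds it strictly by \<open>Max (f t)\<close>; for infinite
    \<open>f t\<close> no bound is required.\<close>
  have "lax_less (nonzero_part T f) g f"
    unfolding lax_less_def
  proof (intro ballI conjI impI)
    fix t assume t: "t \<in> nonzero_part T f"
    show "Inf (g t) \<le> Inf (f t)"
      using cInf_lower[OF zero[OF t]] by simp
    assume fin: "finite (f t)"
    have sub: "g t \<subseteq> {..<Max (f t)}"
      using fin by (auto simp: g_def intro: less_le_trans)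
    then show "finite (g t)" by (rule finite_subset) simp
    then have "Max (g t) \<in> g t" using zero[OF t] by (intro Max_in) auto
    then show "Max (g t) < Max (f t)" using sub by auto
  qed
  moreover have "g \<in> nonzero_part T f \<rightarrow> nonempty_nat_sets" using zero by blast
  ultimately have "lax_postfix (nonzero_part T f) g \<Turnstile>\<^sub>l \<phi> \<or> nonzero_part T f = {}"
    by (intro less)
  \<comment> \<open>If \<open>nonzero_part T f\<close> is empty, any element of \<open>A\<close>
    will do; hence the assumption \<open>A \<noteq> {}\<close>.\<close>
  then obtain a where a: "a \<in> A" "\<forall>t\<in>nonzero_part T f. \<forall>j\<in>g t. P a (suffix j t)"
    using \<open>A \<noteq> {}\<close> by (auto simp: \<phi> ball_lax_postfix)
  \<comment> \<open>From \<open>j < s\<close> it follows that \<open>s\<close> is positive, so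
    \<open>t\<close> lies in \<open>nonzero_part T f\<close>. On the other traces
    \<open>f t = {0}\<close> imposes nothing.\<close>
  have "P a (suffix j t)" if "t \<in> T" "s \<in> f t" "j < s" for t s j
    using that a(2) nonzero_partI[of t T s f] by (auto simp: g_def)
  then show ?R using f a(1) by blast
next
  assume ?R
  then obtain a f where f: "f \<in> T \<rightarrow> nonempty_nat_sets" "lax_postfix T f \<Turnstile>\<^sub>l \<psi>"
    and a: "a \<in> A" "\<And>t s j. \<lbrakk>t \<in> T; s \<in> f t; j < s\<rbrakk> \<Longrightarrow> P a (suffix j t)"
    by blast
  have "lax_postfix (nonzero_part T f) f' \<Turnstile>\<^sub>l \<phi>"
    if less: "lax_less (nonzero_part T f) f' f" for f'
    unfolding \<phi> ball_lax_postfix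
  proof (intro bexI[OF _ a(1)] ballI)
    fix t j assume t: "t \<in> nonzero_part T f" and j: "j \<in> f' t"
    have "t \<in> T" using t by (simp add: nonzero_part_def)
    \<comment> \<open>Every position allowed by \<open>f'\<close> precedes one in
      \<open>f t\<close>: the maximum if \<open>f t\<close> is finite, otherwise by
      unboundedness.\<close>
    have "\<exists>s\<in>f t. j < s"
    proof (cases "finite (f t)")
      case True
      then have "finite (f' t)" "Max (f' t) < Max (f t)" using less t by (auto simp: lax_less_def)
      then have "j < Max (f t)" using Max_ge[of "f' t" j] j by linarith
      moreover have "Max (f t) \<in> f t" using True f(1) \<open>t \<in> T\<close> by (intro Max_in) auto
      ultimately show ?thesis by blast
    next
      case False
      then show ?thesis by (auto simp: infinite_nat_iff_unbounded)
    qed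
    then show "P a (suffix j t)" using a(2) \<open>t \<in> T\<close> by blast
  qed
  then show ?L using f by auto
qed

text \<open>
  From right to left, \<open>f t\<close> collects all positions that fulfil the until.
\<close>

lemma ex_lax_postfix_iff:
  "(\<exists>f \<in> T \<rightarrow> nonempty_nat_sets.
      ((\<forall>u\<in>lax_postfix T f. Q u) \<and> (\<forall>R\<in>\<R>. \<exists>u\<in>lax_postfix T f. R u)) \<and>
      (\<forall>t\<in>T. \<forall>s\<in>f t. \<forall>j<s. P (suffix j t))) \<longleftrightarrow>
   (\<forall>t\<in>T. \<exists>s. Q (suffix s t) \<and> (\<forall>j<s. P (suffix j t))) \<and>
   (\<forall>R\<in>\<R>. \<exists>t\<in>T. \<exists>s. (Q (suffix s t) \<and> R (suffix s t)) \<and> (\<forall>j<s. P (suffix j t)))"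
  (is "?L \<longleftrightarrow> ?R")
proof
  assume ?L
  then obtain f where f: "f \<in> T \<rightarrow> nonempty_nat_sets"
    "\<forall>t\<in>T. \<forall>s\<in>f t. Q (suffix s t)"
    "\<forall>R\<in>\<R>. \<exists>t\<in>T. \<exists>s\<in>f t. R (suffix s t)"
    "\<forall>t\<in>T. \<forall>s\<in>f t. \<forall>j<s. P (suffix j t)"
    unfolding ball_lax_postfix bex_lax_postfix by (elim bexE conjE)
  show ?R
  proof (intro conjI ballI)
    fix t assume "t \<in> T"
    moreover from this obtain s where "s \<in> f t" using f(1) by blast
    ultimately show "\<exists>s. Q (suffix s t) \<and> (\<forall>j<s. P (suffix j t))" using f(2,4) by blast
  next
    fix R assume "R \<in> \<R>"
    then obtain t s where "t \<in> T" "s \<in> f t" "R (suffix s t)" using f(3) by blast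
    then show "\<exists>t\<in>T. \<exists>s. (Q (suffix s t) \<and> R (suffix s t)) \<and> (\<forall>j<s. P (suffix j t))"
      using f(2,4) by blast
  qed
next
  assume R: ?R
  define f where "f t = {s. Q (suffix s t) \<and> (\<forall>j<s. P (suffix j t))}" for t
  have "f \<in> T \<rightarrow> nonempty_nat_sets" using R by (auto simp: f_def)
  moreover have "\<exists>t\<in>T. \<exists>s\<in>f t. R (suffix s t)" if "R \<in> \<R>" for R
    using R that unfolding f_def by blast
  ultimately show ?L
    by (intro bexI[of _ f]) (auto simp: ball_lax_postfix bex_lax_postfix f_def)
qed

lemma ltl_flat: "ltl \<phi> \<Longrightarrow> T \<Turnstile>\<^sub>l \<phi> \<longleftrightarrow> (\<forall>t\<in>T. trace_sat t \<phi>)"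
proof (induction \<phi> arbitrary: T)
  case (Disj \<phi> \<psi>)
  show ?case
  proof
    assume "\<forall>t\<in>T. trace_sat t (Disj \<phi> \<psi>)"
    then have "{t\<in>T. trace_sat t \<phi>} \<union> {t\<in>T. trace_sat t \<psi>} = T" by auto
    moreover have "{t\<in>T. trace_sat t \<phi>} \<Turnstile>\<^sub>l \<phi>" "{t\<in>T. trace_sat t \<psi>} \<Turnstile>\<^sub>l \<psi>"
      using Disj by auto
    ultimately show "T \<Turnstile>\<^sub>l Disj \<phi> \<psi>" by (auto simp del: trace_sat.simps)
  qed (use Disj in auto)
next
  case (Glob \<phi>)
  \<comment> \<open>Both temporal cases are instances with a single disjunct; the until case also
    has an empty family of witness conditions.\<close>
  then show ?case
    using Glob_iff_disjunction[of \<phi> "{\<phi>}" "\<lambda>a t. trace_sat t a"] by simp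
next
  case (Until \<phi> \<psi>)
  then show ?case
    using Until_iff_disjunction[of \<phi> "{\<phi>}" "\<lambda>a t. trace_sat t a" T \<psi>]
      ex_lax_postfix_iff[of T "\<lambda>t. trace_sat t \<psi>" "{}" "\<lambda>t. trace_sat t \<phi>"]
    by simp
qed auto

section \<open>Dual formulae and witnesses\<close>

lemma ltl_Top [simp]: "ltl Top"
  by (simp add: Top_def)

lemma trace_sat_Top [simp]: "trace_sat t Top"
  by (simp add: Top_def)

lemma ltl_dual [simp]: "ltl \<phi> \<Longrightarrow> ltl (dual \<phi>)"
  by (induction \<phi>) auto

text \<open>If \<open>Q\<close> ever holds, consider its first position: the until fails there, so
  \<open>P\<close> fails earlier, before any \<open>Q\<close>. Conversely, a position fulfilling the
  until can lie neither before, at, nor after such a failure of \<open>P\<close>. This is the last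
  equation of \<open>dual\<close>.\<close>

lemma not_until_iff_weak_until:
  fixes P Q :: "nat \<Rightarrow> bool"
  shows "\<not> (\<exists>s. Q s \<and> (\<forall>j<s. P j)) \<longleftrightarrow>
    (\<exists>s. (\<not> P s \<and> \<not> Q s) \<and> (\<forall>j<s. \<not> Q j)) \<or> (\<forall>s. \<not> Q s)"
proof
  assume L: "\<not> (\<exists>s. Q s \<and> (\<forall>j<s. P j))"
  show "(\<exists>s. (\<not> P s \<and> \<not> Q s) \<and> (\<forall>j<s. \<not> Q j)) \<or> (\<forall>s. \<not> Q s)"
  proof (rule disjCI)
    assume "\<not> (\<forall>s. \<not> Q s)"
    then obtain n where n: "Q n" "\<forall>j<n. \<not> Q j" using exists_least_iff[of Q] by blast
    then obtain k where "k < n" "\<not> P k" using L by blast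
    then show "\<exists>s. (\<not> P s \<and> \<not> Q s) \<and> (\<forall>j<s. \<not> Q j)" using n(2) less_trans by blast
  qed
next
  assume "(\<exists>s. (\<not> P s \<and> \<not> Q s) \<and> (\<forall>j<s. \<not> Q j)) \<or> (\<forall>s. \<not> Q s)"
  then show "\<not> (\<exists>s. Q s \<and> (\<forall>j<s. P j))" by (metis linorder_neqE_nat)
qed

lemma trace_sat_dual [simp]: "ltl \<phi> \<Longrightarrow> trace_sat t (dual \<phi>) \<longleftrightarrow> \<not> trace_sat t \<phi>"
proof (induction \<phi> arbitrary: t)
  case (Until \<phi> \<psi>)
  then show ?case
    using not_until_iff_weak_until[of "\<lambda>s. trace_sat (suffix s t) \<psi>" "\<lambda>s. trace_sat (suffix s t) \<phi>"]
    by simp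
qed auto

lemma Exists_iff: "ltl \<beta> \<Longrightarrow> T \<Turnstile>\<^sub>l Exists \<beta> \<longleftrightarrow> (\<exists>t\<in>T. trace_sat t \<beta>)"
  by (simp add: Exists_def ltl_flat)

section \<open>Quasi-flat normal form\<close>

text \<open>The pair \<open>(\<alpha>, \<beta>s)\<close> stands for the formula \<open>flat_disjunct \<alpha> \<beta>s\<close>.\<close>

fun disjunct_sat :: "'p trace set \<Rightarrow> 'p fm \<times> 'p fm list \<Rightarrow> bool" where
  "disjunct_sat T (\<alpha>, \<beta>s) \<longleftrightarrow>
     (\<forall>t\<in>T. trace_sat t \<alpha>) \<and> (\<forall>\<beta>\<in>set \<beta>s. \<exists>t\<in>T. trace_sat t \<beta>)"

fun disjunct_ltl :: "'p fm \<times> 'p fm list \<Rightarrow> bool" where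
  "disjunct_ltl (\<alpha>, \<beta>s) \<longleftrightarrow> ltl \<alpha> \<and> (\<forall>\<beta>\<in>set \<beta>s. ltl \<beta>)"

lemma flat_disjunct_iff:
  "disjunct_ltl (\<alpha>, \<beta>s) \<Longrightarrow> T \<Turnstile>\<^sub>l flat_disjunct \<alpha> \<beta>s \<longleftrightarrow> disjunct_sat T (\<alpha>, \<beta>s)"
proof (induction \<beta>s rule: rev_induct)
  case Nil
  then show ?case by (simp add: flat_disjunct_def ltl_flat)
next
  case (snoc \<beta> \<beta>s)
  then show ?case by (auto simp: flat_disjunct_def Exists_iff)
qed

lemma big_bdisj_iff: "\<phi>s \<noteq> [] \<Longrightarrow> T \<Turnstile>\<^sub>l big_bdisj \<phi>s \<longleftrightarrow> (\<exists>\<phi>\<in>set \<phi>s. T \<Turnstile>\<^sub>l \<phi>)"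
  by (induction \<phi>s rule: big_bdisj.induct) auto

section \<open>Connectives acting on disjuncts\<close>

fun conj_disjunct :: "'p fm \<times> 'p fm list \<Rightarrow> 'p fm \<times> 'p fm list \<Rightarrow> 'p fm \<times> 'p fm list" where
  "conj_disjunct (\<alpha>, \<beta>s) (\<gamma>, \<delta>s) = (Conj \<alpha> \<gamma>, \<beta>s @ \<delta>s)"

fun disj_disjunct :: "'p fm \<times> 'p fm list \<Rightarrow> 'p fm \<times> 'p fm list \<Rightarrow> 'p fm \<times> 'p fm list" where
  "disj_disjunct (\<alpha>, \<beta>s) (\<gamma>, \<delta>s) = (Disj \<alpha> \<gamma>, map (Conj \<alpha>) \<beta>s @ map (Conj \<gamma>) \<delta>s)"

text \<open>A disjunct fails in one of two ways, each again a disjunct: some trace violates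
  \<alpha>, or some \<beta> has no witness, so that all traces satisfy its dual.\<close>

fun neg_disjunct :: "'p fm \<times> 'p fm list \<Rightarrow> ('p fm \<times> 'p fm list) list" where
  "neg_disjunct (\<alpha>, \<beta>s) = (Top, [dual \<alpha>]) # map (\<lambda>\<beta>. (dual \<beta>, [])) \<beta>s"

fun next_disjunct :: "'p fm \<times> 'p fm list \<Rightarrow> 'p fm \<times> 'p fm list" where
  "next_disjunct (\<alpha>, \<beta>s) = (Next \<alpha>, map Next \<beta>s)"

fun until_disjunct :: "'p fm \<Rightarrow> 'p fm \<times> 'p fm list \<Rightarrow> 'p fm \<times> 'p fm list" where
  "until_disjunct \<alpha> (\<gamma>, \<delta>s) = (Until \<alpha> \<gamma>, map (\<lambda>\<delta>. Until \<alpha> (Conj \<gamma> \<delta>)) \<delta>s)"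

definition list_prod_with :: "('a \<Rightarrow> 'b \<Rightarrow> 'c) \<Rightarrow> 'a list \<Rightarrow> 'b list \<Rightarrow> 'c list" where
  "list_prod_with h xs ys = map (\<lambda>(x, y). h x y) (List.product xs ys)"

lemma set_list_prod_with [simp]:
  "set (list_prod_with h xs ys) = {h x y | x y. x \<in> set xs \<and> y \<in> set ys}"
  by (auto simp: list_prod_with_def)

text \<open>
  In the cases \<open>Glob\<close> and \<open>Until\<close> the witness lists of the left operand are dropped: they are
  empty when that operand is without Boolean negation.
\<close>

primrec normal_form :: "'p fm \<Rightarrow> ('p fm \<times> 'p fm list) list" where
  "normal_form (Atom p) = [(Atom p, [])]"
| "normal_form (NegAtom p) = [(NegAtom p, [])]"
| "normal_form (Conj \<phi> \<psi>) = list_prod_with conj_disjunct (normal_form \<phi>) (normal_form \<psi>)"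
| "normal_form (Disj \<phi> \<psi>) = list_prod_with disj_disjunct (normal_form \<phi>) (normal_form \<psi>)"
| "normal_form (BDisj \<phi> \<psi>) = normal_form \<phi> @ normal_form \<psi>"
| "normal_form (BNeg \<phi>) =
     foldr (\<lambda>d. list_prod_with conj_disjunct (neg_disjunct d)) (normal_form \<phi>) [(Top, [])]"
| "normal_form (Next \<phi>) = map next_disjunct (normal_form \<phi>)"
| "normal_form (Glob \<phi>) = map (\<lambda>d. (Glob (fst d), [])) (normal_form \<phi>)"
| "normal_form (Until \<phi> \<psi>) =
     list_prod_with (\<lambda>d. until_disjunct (fst d)) (normal_form \<phi>) (normal_form \<psi>)"

section \<open>Shape of the normal form\<close>

lemma list_prod_with_ltl:
  assumes "\<forall>d\<in>set ds. disjunct_ltl d" "\<forall>e\<in>set es. disjunct_ltl e"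
    and "\<And>d e. \<lbrakk>disjunct_ltl d; disjunct_ltl e\<rbrakk> \<Longrightarrow> disjunct_ltl (h d e)"
  shows "\<forall>d\<in>set (list_prod_with h ds es). disjunct_ltl d"
  unfolding set_list_prod_with using assms by blast

lemma conj_disjunct_ltl: "\<lbrakk>disjunct_ltl d; disjunct_ltl e\<rbrakk> \<Longrightarrow> disjunct_ltl (conj_disjunct d e)"
  by (cases d; cases e) auto

lemma disj_disjunct_ltl: "\<lbrakk>disjunct_ltl d; disjunct_ltl e\<rbrakk> \<Longrightarrow> disjunct_ltl (disj_disjunct d e)"
  by (cases d; cases e) auto

lemma neg_disjunct_ltl: "disjunct_ltl d \<Longrightarrow> \<forall>e\<in>set (neg_disjunct d). disjunct_ltl e"
  by (cases d) auto

lemma next_disjunct_ltl: "disjunct_ltl d \<Longrightarrow> disjunct_ltl (next_disjunct d)"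
  by (cases d) auto

lemma until_disjunct_ltl:
  "\<lbrakk>disjunct_ltl d; disjunct_ltl e\<rbrakk> \<Longrightarrow> disjunct_ltl (until_disjunct (fst d) e)"
  by (cases d; cases e) auto

lemma foldr_conj_disjunct_ltl:
  "\<forall>d\<in>set ds. disjunct_ltl d \<Longrightarrow>
   \<forall>e\<in>set (foldr (\<lambda>d. list_prod_with conj_disjunct (neg_disjunct d)) ds [(Top, [])]). disjunct_ltl e"
proof (induction ds)
  case (Cons d ds)
  then show ?case
    unfolding foldr.simps comp_def
    by (intro list_prod_with_ltl conj_disjunct_ltl neg_disjunct_ltl) auto
qed simp

lemma normal_form_ltl: "\<forall>d\<in>set (normal_form \<phi>). disjunct_ltl d"
proof (induction \<phi>)
  case (Conj \<phi> \<psi>)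
  then show ?case unfolding normal_form.simps by (intro list_prod_with_ltl conj_disjunct_ltl)
next
  case (Disj \<phi> \<psi>)
  then show ?case unfolding normal_form.simps by (intro list_prod_with_ltl disj_disjunct_ltl)
next
  case (BNeg \<phi>)
  then show ?case unfolding normal_form.simps by (rule foldr_conj_disjunct_ltl)
next
  case (Next \<phi>)
  then show ?case by (auto intro: next_disjunct_ltl)
next
  case (Until \<phi> \<psi>)
  then show ?case unfolding normal_form.simps by (intro list_prod_with_ltl until_disjunct_ltl)
qed auto

lemma list_prod_with_eq_Nil [simp]: "list_prod_with h xs ys = [] \<longleftrightarrow> xs = [] \<or> ys = []"
  by (simp add: list_prod_with_def flip: length_0_conv)

text \<open>Used both for \<open>big_bdisj\<close>, which is meaningful only on nonempty lists, and
  for the nonempty set of disjuncts in \<open>Until_iff_disjunction\<close>.\<close>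

lemma normal_form_nonempty: "normal_form \<phi> \<noteq> []"
proof (induction \<phi>)
  case (BNeg \<phi>)
  have "neg_disjunct d \<noteq> []" for d :: "'a fm \<times> 'a fm list" by (cases d) simp
  then have "foldr (\<lambda>d. list_prod_with conj_disjunct (neg_disjunct d)) ds [(Top, [])] \<noteq> []"
    for ds :: "('a fm \<times> 'a fm list) list"
    by (induction ds) auto
  then show ?case by simp
qed auto

text \<open>Witnesses originate only in \<open>neg_disjunct\<close>; the other operations turn empty
  witness lists into empty ones.\<close>

lemma normal_form_teamltl_bor:
  "teamltl_bor \<phi> \<Longrightarrow> \<forall>d\<in>set (normal_form \<phi>). snd d = []"
  by (induction \<phi>) fastforce+

section \<open>Truth of the normal form in teams\<close>

lemma bex_list_prod_with:
  "(\<exists>z\<in>set (list_prod_with h xs ys). P z) \<longleftrightarrow> (\<exists>x\<in>set xs. \<exists>y\<in>set ys. P (h x y))"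
  by auto

lemma conj_disjunct_sat:
  "disjunct_sat T (conj_disjunct d e) \<longleftrightarrow> disjunct_sat T d \<and> disjunct_sat T e"
  by (cases d; cases e) auto

text \<open>A witness must lie in the part of the team it belongs to, hence the added
  \<open>Conj \<alpha>\<close> and \<open>Conj \<gamma>\<close>. Conversely, the largest possible
  parts retain all such witnesses.\<close>

lemma disj_disjunct_sat:
  "disjunct_sat T (disj_disjunct d e) \<longleftrightarrow>
     (\<exists>T1 T2. T1 \<union> T2 = T \<and> disjunct_sat T1 d \<and> disjunct_sat T2 e)"
proof (cases d; cases e)
  fix \<alpha> \<beta>s \<gamma> \<delta>s assume de: "d = (\<alpha>, \<beta>s)" "e = (\<gamma>, \<delta>s)"
  show ?thesis
  proof
    assume *: "disjunct_sat T (disj_disjunct d e)"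
    have "{t\<in>T. trace_sat t \<alpha>} \<union> {t\<in>T. trace_sat t \<gamma>} = T" using * de by auto
    moreover have "disjunct_sat {t\<in>T. trace_sat t \<alpha>} d" "disjunct_sat {t\<in>T. trace_sat t \<gamma>} e"
      using * de by (auto simp: ball_Un)
    ultimately show "\<exists>T1 T2. T1 \<union> T2 = T \<and> disjunct_sat T1 d \<and> disjunct_sat T2 e" by blast
  next
    assume "\<exists>T1 T2. T1 \<union> T2 = T \<and> disjunct_sat T1 d \<and> disjunct_sat T2 e"
    then show "disjunct_sat T (disj_disjunct d e)" unfolding de by fastforce
  qed
qed

lemma neg_disjunct_sat:
  "disjunct_ltl d \<Longrightarrow> (\<exists>e\<in>set (neg_disjunct d). disjunct_sat T e) \<longleftrightarrow> \<not> disjunct_sat T d"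
  by (cases d) auto

text \<open>De Morgan: the negated disjuncts are conjoined, and each conjunction is distributed back
  into a disjunction. \<open>(Top, [])\<close> is the empty conjunction.\<close>

lemma foldr_conj_disjunct_sat:
  "\<forall>d\<in>set ds. disjunct_ltl d \<Longrightarrow>
   (\<exists>e\<in>set (foldr (\<lambda>d. list_prod_with conj_disjunct (neg_disjunct d)) ds [(Top, [])]).
      disjunct_sat T e) \<longleftrightarrow> (\<forall>d\<in>set ds. \<not> disjunct_sat T d)"
proof (induction ds)
  case (Cons d ds)
  then show ?case
    unfolding foldr.simps comp_def bex_list_prod_with conj_disjunct_sat
    by (simp flip: neg_disjunct_sat)
qed simp

lemma next_disjunct_sat: "disjunct_sat T (next_disjunct d) \<longleftrightarrow> disjunct_sat (suffix 1 ` T) d"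
  by (cases d) auto

text \<open>All chosen positions must satisfy \<gamma>, so a position witnessing a \<delta> has to
  satisfy \<gamma> as well; this explains the \<open>Conj \<gamma> \<delta>\<close>.\<close>

lemma until_disjunct_sat:
  "disjunct_sat T (until_disjunct \<alpha> d) \<longleftrightarrow>
     (\<exists>f \<in> T \<rightarrow> nonempty_nat_sets. disjunct_sat (lax_postfix T f) d \<and>
        (\<forall>t\<in>T. \<forall>s\<in>f t. \<forall>j<s. trace_sat (suffix j t) \<alpha>))"
proof (cases d)
  case (Pair \<gamma> \<delta>s)
  then show ?thesis
    using ex_lax_postfix_iff[of T "\<lambda>t. trace_sat t \<gamma>" "(\<lambda>\<delta> t. trace_sat t \<delta>) ` set \<delta>s"
        "\<lambda>t. trace_sat t \<alpha>"]
    by simp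
qed

text \<open>Brings the left operand into the form that \<open>Glob_iff_disjunction\<close> and
  \<open>Until_iff_disjunction\<close> assume, with the disjuncts as \<open>A\<close>.\<close>

lemma normal_form_sat_teamltl_bor:
  assumes "teamltl_bor \<phi>" and "T \<Turnstile>\<^sub>l \<phi> \<longleftrightarrow> (\<exists>d\<in>set (normal_form \<phi>). disjunct_sat T d)"
  shows "T \<Turnstile>\<^sub>l \<phi> \<longleftrightarrow> (\<exists>d\<in>set (normal_form \<phi>). \<forall>t\<in>T. trace_sat t (fst d))"
proof -
  have "disjunct_sat T d \<longleftrightarrow> (\<forall>t\<in>T. trace_sat t (fst d))" if "d \<in> set (normal_form \<phi>)" for d
    using normal_form_teamltl_bor[OF assms(1)] that by (cases d) auto
  then show ?thesis using assms(2) by simp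
qed

lemma normal_form_sat:
  "left_downward_closed \<phi> \<Longrightarrow> T \<Turnstile>\<^sub>l \<phi> \<longleftrightarrow> (\<exists>d\<in>set (normal_form \<phi>). disjunct_sat T d)"
proof (induction \<phi> arbitrary: T)
  case (Conj \<phi> \<psi>)
  then show ?case by (simp only: normal_form.simps bex_list_prod_with conj_disjunct_sat) auto
next
  case (Disj \<phi> \<psi>)
  then have "T \<Turnstile>\<^sub>l Disj \<phi> \<psi> \<longleftrightarrow> (\<exists>T1 T2. T1 \<union> T2 = T \<and>
      (\<exists>d\<in>set (normal_form \<phi>). disjunct_sat T1 d) \<and> (\<exists>d\<in>set (normal_form \<psi>). disjunct_sat T2 d))"
    by simp
  then show ?case unfolding normal_form.simps bex_list_prod_with disj_disjunct_sat by blast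
next
  case (BDisj \<phi> \<psi>)
  then show ?case by auto
next
  case (BNeg \<phi>)
  then show ?case
    unfolding normal_form.simps foldr_conj_disjunct_sat[OF normal_form_ltl] by simp
next
  case (Next \<phi>)
  then show ?case by (simp add: next_disjunct_sat)
next
  case (Glob \<phi>)
  then have "U \<Turnstile>\<^sub>l \<phi> \<longleftrightarrow> (\<exists>d\<in>set (normal_form \<phi>). \<forall>t\<in>U. trace_sat t (fst d))" for U
    by (intro normal_form_sat_teamltl_bor) simp_all
  from Glob_iff_disjunction[OF this] show ?case by simp
next
  case (Until \<phi> \<psi>)
  then have "U \<Turnstile>\<^sub>l \<phi> \<longleftrightarrow> (\<exists>d\<in>set (normal_form \<phi>). \<forall>t\<in>U. trace_sat t (fst d))" for U
    by (intro normal_form_sat_teamltl_bor) simp_all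
  \<comment> \<open>The right operand may contain Boolean negation; its induction hypothesis is
    applied to the team \<open>lax_postfix T f\<close>, and the choice of its disjunct then moves in
    front of \<open>f\<close>.\<close>
  from Until_iff_disjunction[OF this, of T \<psi>] Until
  have "T \<Turnstile>\<^sub>l Until \<phi> \<psi> \<longleftrightarrow>
    (\<exists>d\<in>set (normal_form \<phi>). \<exists>f \<in> T \<rightarrow> nonempty_nat_sets.
       (\<exists>e\<in>set (normal_form \<psi>). disjunct_sat (lax_postfix T f) e) \<and>
       (\<forall>t\<in>T. \<forall>s\<in>f t. \<forall>j<s. trace_sat (suffix j t) (fst d)))"
    by (simp add: normal_form_nonempty del: team_sat.simps)
  then show ?case unfolding normal_form.simps bex_list_prod_with until_disjunct_sat by blast
qed auto

theorem theorem14: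
  fixes \<phi> :: "'p fm"
  assumes "left_downward_closed \<phi>"
  shows "\<exists>\<phi>'. quasi_flat \<phi>' \<and> logically_equivalent \<phi> \<phi>'"
proof (intro exI conjI)
  let ?\<phi>' = "big_bdisj (map (\<lambda>(\<alpha>, \<beta>s). flat_disjunct \<alpha> \<beta>s) (normal_form \<phi>))"
  have ltl: "\<forall>(\<alpha>, \<beta>s)\<in>set (normal_form \<phi>). ltl \<alpha> \<and> (\<forall>\<beta>\<in>set \<beta>s. ltl \<beta>)"
    using normal_form_ltl[of \<phi>] by fastforce
  then show "quasi_flat ?\<phi>'"
    unfolding quasi_flat_def using normal_form_nonempty[of \<phi>] by blast
  \<comment> \<open>Gives the formula read off from the list the same truth condition that
    \<open>normal_form_sat\<close> gives \<phi>.\<close>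
  have "T \<Turnstile>\<^sub>l ?\<phi>' \<longleftrightarrow> (\<exists>d\<in>set (normal_form \<phi>). disjunct_sat T d)" for T
  proof -
    have "T \<Turnstile>\<^sub>l ?\<phi>' \<longleftrightarrow> (\<exists>(\<alpha>, \<beta>s)\<in>set (normal_form \<phi>). T \<Turnstile>\<^sub>l flat_disjunct \<alpha> \<beta>s)"
      by (simp add: big_bdisj_iff normal_form_nonempty case_prod_unfold)
    also have "\<dots> \<longleftrightarrow> (\<exists>d\<in>set (normal_form \<phi>). disjunct_sat T d)"
      using normal_form_ltl[of \<phi>] flat_disjunct_iff
      by (intro bex_cong) (auto simp del: disjunct_sat.simps disjunct_ltl.simps)
    finally show ?thesis .
  qed
  then show "logically_equivalent \<phi> ?\<phi>'"
    using assms by (simp add: logically_equivalent_def normal_form_sat)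
qed

end
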